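(* Let $(x,y)\in\mathbb{R}^2$ and $0<\theta<2\pi$, and suppose that the left turn-to-bearing path starting at the origin with orientation $0$, with radius $r=R(x,y,\theta)>0$ and bearing offset $\theta$, arrives at $(x,y)$ with orientation $\theta$, i.e. $H_{r,\theta}(d)=(x,y)$ for some $d\ge r\theta$. Then $$L(x,y,\theta,R(x,y,\theta))=x\Big(\cot\big(\tfrac{\theta}{2}\big)\theta-1\Big)+y\Big(\cot\big(\tfrac{\theta}{2}\big)-\frac{\cos\theta}{1-\cos\theta}\,\theta\Big).$$
   Context: $R(x,y,\theta)=\dfrac{x\sin\theta-y\cos\theta}{1-\cos\theta}$; $L(x,y,\theta,r)=r\theta+\|(x,y)-r(\sin\theta,1-\cos\theta)\|$ (Euclidean norm). For $r>0$, $0<\theta_c<2\pi$: $H_{r,\theta_c}(d)=(r\sin(d/r),\ r(1-\cos(d/r)))$ for $0\le d\le r\theta_c$ and $H_{r,\theta_c}(d)=((d-r\theta_c)\cos\theta_c+r\sin\theta_c,\ (d-r\theta_c)\sin\theta_c+r(1-\cos\theta_c))$ for $d>r\theta_c$. *)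

theory Defs
  imports "HOL-Analysis.Analysis"
begin

text \<open>The plane is \<^typ>\<open>real \<times> real\<close>, whose norm is the Euclidean one.\<close>

definition turn_radius :: "real \<Rightarrow> real \<Rightarrow> real \<Rightarrow> real" where
  "turn_radius x y \<theta> = (x * sin \<theta> - y * cos \<theta>) / (1 - cos \<theta>)"

definition path_length :: "real \<Rightarrow> real \<Rightarrow> real \<Rightarrow> real \<Rightarrow> real" where
  "path_length x y \<theta> r = r * \<theta> + norm ((x, y) - r *\<^sub>R (sin \<theta>, 1 - cos \<theta>))"

text \<open>
  The left turn-to-bearing path from the origin with initial orientation \<open>0\<close>, parametrised by
  arc length \<open>d\<close>: an arc of radius \<open>r\<close> and angle \<open>\<theta>\<^sub>c\<close>, followed by a ray in direction \<open>\<theta>\<^sub>c\<close>.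
  Only \<open>r > 0\<close>, \<open>0 < \<theta>\<^sub>c < 2 * pi\<close> and \<open>d \<ge> 0\<close> are meaningful.
\<close>
definition turn_path :: "real \<Rightarrow> real \<Rightarrow> real \<Rightarrow> real \<times> real" where
  "turn_path r \<theta>\<^sub>c d =
    (if d \<le> r * \<theta>\<^sub>c
     then (r * sin (d / r), r * (1 - cos (d / r)))
     else ((d - r * \<theta>\<^sub>c) * cos \<theta>\<^sub>c + r * sin \<theta>\<^sub>c,
           (d - r * \<theta>\<^sub>c) * sin \<theta>\<^sub>c + r * (1 - cos \<theta>\<^sub>c)))"

end

theory Submission
  imports Defs
begin

text \<open>The end point is t(cos \<theta>, sin \<theta>) + r(sin \<theta>, 1 - cos \<theta>), with
  \<open>t = d - r * \<theta>\<close> the length of the straight part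
  (\<open>turn_path_ray\<close>), so the path length is r\<theta> + t. Both unknowns are linear in x
  and y: t = y cot(\<theta>/2) - x, and r = x cot(\<theta>/2) - y cos \<theta>/(1 - cos \<theta>) by
  the definition of R and \<open>cot_half\<close>. Substituting them gives the formula.\<close>

text \<open>Double-angle formulas; where \<open>sin (\<theta> / 2)\<close> vanishes, both quotients
  are 0 by the convention on division by zero.\<close>

lemma cot_half:
  fixes \<theta> :: real
  shows "cot (\<theta> / 2) = sin \<theta> / (1 - cos \<theta>)"
proof -
  have "sin \<theta> = 2 * sin (\<theta> / 2) * cos (\<theta> / 2)"
    using sin_double[of "\<theta> / 2"] by simp
  moreover have "1 - cos \<theta> = 2 * (sin (\<theta> / 2))\<^sup>2"
    using cos_double_sin[of "\<theta> / 2"] by simp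
  ultimately show ?thesis
    by (simp add: cot_def power2_eq_square)
qed

text \<open>Arc and ray meet at \<open>d = r * \<theta>\<close>, so the ray formula extends to that
  end point; there \<open>r > 0\<close> gives \<open>d / r = \<theta>\<close>.\<close>

lemma turn_path_ray:
  assumes "r > 0" and "d \<ge> r * \<theta>"
  shows "turn_path r \<theta> d =
    (d - r * \<theta>) *\<^sub>R (cos \<theta>, sin \<theta>) + r *\<^sub>R (sin \<theta>, 1 - cos \<theta>)"
proof (cases "d = r * \<theta>")
  case True
  with assms(1) show ?thesis by (simp add: turn_path_def)
next
  case False
  with assms(2) show ?thesis by (simp add: turn_path_def)
qed

theorem theorem12:
  fixes x y \<theta> :: real
  assumes "0 < \<theta>" and "\<theta> < 2 * pi"
    and "turn_radius x y \<theta> > 0"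
    and "\<exists>d \<ge> turn_radius x y \<theta> * \<theta>. turn_path (turn_radius x y \<theta>) \<theta> d = (x, y)"
  shows "path_length x y \<theta> (turn_radius x y \<theta>) =
    x * (cot (\<theta> / 2) * \<theta> - 1) + y * (cot (\<theta> / 2) - cos \<theta> / (1 - cos \<theta>) * \<theta>)"
proof -
  define r where "r = turn_radius x y \<theta>"
  obtain d where d: "d \<ge> r * \<theta>" and path: "turn_path r \<theta> d = (x, y)"
    using assms(4) unfolding r_def by blast
  define t where "t = d - r * \<theta>"
  have xy: "(x, y) = t *\<^sub>R (cos \<theta>, sin \<theta>) + r *\<^sub>R (sin \<theta>, 1 - cos \<theta>)"
    using turn_path_ray[of r \<theta> d] assms(3) d path by (simp add: r_def t_def)
  have x: "x = t * cos \<theta> + r * sin \<theta>" and y: "y = t * sin \<theta> + r * (1 - cos \<theta>)"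
    using xy by simp_all
  \<comment> \<open>Otherwise the quotient defining the radius would be 0, not positive.\<close>
  have "1 - cos \<theta> \<noteq> 0"
    using assms(3) by (auto simp: turn_radius_def)
  then have cot: "cot (\<theta> / 2) * (1 - cos \<theta>) = sin \<theta>"
    \<comment> \<open>Uses the factorisation sin^2 = (1 - cos)(1 + cos).\<close>
    and cot': "cot (\<theta> / 2) * sin \<theta> = 1 + cos \<theta>"
    using sin_squared_eq[of \<theta>]
    by (simp_all add: cot_half field_simps power2_eq_square)
  have "norm ((x, y) - r *\<^sub>R (sin \<theta>, 1 - cos \<theta>)) = norm (t *\<^sub>R (cos \<theta>, sin \<theta>))"
    by (simp only: xy add_diff_cancel_right')
  \<comment> \<open>The direction is a unit vector and t is nonnegative; keeping the scalar outside
    the pair lets the norm split as a product.\<close>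
  also have "\<dots> = t"
    using d by (simp add: norm_Pair t_def del: scaleR_Pair)
  finally have "path_length x y \<theta> r = r * \<theta> + t"
    by (simp add: path_length_def)
  \<comment> \<open>Multiplying y by the cotangent turns it into t(1 + cos \<theta>) + r sin
    \<theta>, which exceeds x by exactly t.\<close>
  moreover have "y * cot (\<theta> / 2) - x = t"
  proof -
    have "y * cot (\<theta> / 2) = t * (cot (\<theta> / 2) * sin \<theta>) + r * (cot (\<theta> / 2) * (1 - cos \<theta>))"
      by (simp add: y algebra_simps)
    also have "\<dots> = t + x"
      unfolding cot cot' x by (simp add: distrib_left)
    finally show ?thesis by simp
  qed
  moreover have "x * cot (\<theta> / 2) - y * (cos \<theta> / (1 - cos \<theta>)) = r"
    by (simp add: r_def turn_radius_def cot_half diff_divide_distrib)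
  ultimately have "path_length x y \<theta> r =
      (x * cot (\<theta> / 2) - y * (cos \<theta> / (1 - cos \<theta>))) * \<theta> + (y * cot (\<theta> / 2) - x)"
    by simp
  then show ?thesis
    unfolding r_def by (simp add: algebra_simps)
qed

end
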